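(* Let $A$ be an additive abelian group and let $\varphi\in\operatorname{Aut}A$. For the Alexander quandle $Q=\operatorname{Alex}(A,\varphi)$, the following are equivalent: (1) $Q$ is a connected kei. (2) $A$ is $2$-divisible, and $Q$ equals the Takasaki kei $T(A)$.
   Context: A quandle is a pair $(X,s)$ where $X$ is a set and $s:X\to S_X$, $x\mapsto s_x$, is a function to the symmetric group $S_X$ such that $s_xs_y=s_{s_x(y)}s_x$ and $s_x(x)=x$ for all $x,y\in X$. A quandle is a kei (or involutory) if $s_x^2=\mathrm{id}_X$ for all $x\in X$. The inner automorphism group $\operatorname{Inn}(X,s)$ is the subgroup of $S_X$ generated by $\{s_x\mid x\in X\}$; the quandle is connected if $\operatorname{Inn}(X,s)$ acts transitively on $X$. For an additive abelian group $A$ and $\varphi\in\operatorname{Aut}A$, the Alexander quandle $\operatorname{Alex}(A,\varphi)$ has underlying set $A$ and $s_a(b):=\varphi(b-a)+a$ for all $a,b\in A$. The Takasaki kei $T(A)$ is $\operatorname{Alex}(A,\varphi)$ with $\varphi$ the inversion map $a\mapsto -a$. The group $A$ is $2$-divisible if the map $A\to A$, $a\mapsto 2a$, is surjective. *)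

theory Defs
  imports "HOL-Algebra.Group_Action" "HOL-Algebra.Generated_Groups" "HOL-Algebra.Ring"
begin

text \<open>
  A pair \<open>(X, s)\<close> has an explicit underlying set \<open>X\<close>. The symmetric group on \<open>X\<close> is
  \<^const>\<open>BijGroup\<close>, whose elements are extensional functions. The family \<open>s\<close> is required to be
  extensional as well (\<open>\<rightarrow>\<^sub>E\<close>), so that equality of pairs is equality of quandles.
\<close>

type_synonym 'a quandle = "'a set \<times> ('a \<Rightarrow> 'a \<Rightarrow> 'a)"

definition is_quandle :: "'a quandle \<Rightarrow> bool" where
  "is_quandle Q \<longleftrightarrow>
     (case Q of (X, s) \<Rightarrow>
        s \<in> X \<rightarrow>\<^sub>E carrier (BijGroup X) \<and>
        (\<forall>x\<in>X. \<forall>y\<in>X. s x \<otimes>\<^bsub>BijGroup X\<^esub> s y = s (s x y) \<otimes>\<^bsub>BijGroup X\<^esub> s x) \<and>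
        (\<forall>x\<in>X. s x x = x))"

definition is_kei :: "'a quandle \<Rightarrow> bool" where
  "is_kei Q \<longleftrightarrow>
     is_quandle Q \<and>
     (case Q of (X, s) \<Rightarrow> \<forall>x\<in>X. s x [^]\<^bsub>BijGroup X\<^esub> (2::nat) = \<one>\<^bsub>BijGroup X\<^esub>)"

definition Inn :: "'a quandle \<Rightarrow> ('a \<Rightarrow> 'a) monoid" where
  "Inn Q = (case Q of (X, s) \<Rightarrow> BijGroup X \<lparr>carrier := generate (BijGroup X) (s ` X)\<rparr>)"

definition is_connected :: "'a quandle \<Rightarrow> bool" where
  "is_connected Q \<longleftrightarrow> is_quandle Q \<and> transitive_action (Inn Q) (fst Q) (\<lambda>g. g)"

text \<open>
  An additive abelian group is an \<^locale>\<open>abelian_group\<close>, which constrains only the additive part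
  of its ring record; the multiplicative components are ignored throughout. Its automorphisms are
  the elements of \<open>auto (add_monoid A)\<close>.
\<close>

definition Alex :: "('a, 'b) ring_scheme \<Rightarrow> ('a \<Rightarrow> 'a) \<Rightarrow> 'a quandle" where
  "Alex A \<phi> =
     (carrier A, \<lambda>a\<in>carrier A. \<lambda>b\<in>carrier A. \<phi> (b \<ominus>\<^bsub>A\<^esub> a) \<oplus>\<^bsub>A\<^esub> a)"

definition Takasaki :: "('a, 'b) ring_scheme \<Rightarrow> 'a quandle" where
  "Takasaki A = Alex A (\<lambda>a\<in>carrier A. \<ominus>\<^bsub>A\<^esub> a)"

definition two_divisible :: "('a, 'b) ring_scheme \<Rightarrow> bool" where
  "two_divisible A \<longleftrightarrow> (\<lambda>a. [(2::nat)] \<cdot>\<^bsub>A\<^esub> a) ` carrier A = carrier A"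

end

theory Submission
  imports Defs
begin

text \<open>
  Write \<open>\<delta> a = a - \<phi> a\<close>. Since \<open>\<phi>\<close> is additive, the Alexander operation is the affine map
  \<open>s\<^sub>a b = \<phi> b + \<delta> a\<close>, and both properties in question can be read off from \<open>\<phi>\<close> and \<open>\<delta>\<close>.

  The quandle is connected exactly when \<open>\<delta>\<close> is onto (\<open>is_connected_Alex_iff\<close>). Indeed
  \<open>s\<^sub>a b - b = \<delta> (a - b)\<close>, so every \<open>s\<^sub>a\<close>, and with it the whole inner automorphism group, preserves
  each coset of the subgroup \<open>\<delta> A\<close>; transitivity leaves room for one coset only. Conversely, if
  \<open>\<delta>\<close> is onto, the same formula gives for any \<open>b\<close>, \<open>c\<close> a single \<open>s\<^sub>a\<close> that moves \<open>b\<close> to \<open>c\<close>.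

  The quandle is a kei exactly when \<open>\<phi>\<close> is an involution (\<open>is_kei_Alex_iff\<close>), because
  \<open>s\<^sub>a (s\<^sub>a b) = \<phi> (\<phi> b) + \<delta> (a + \<phi> a)\<close>, where the last summand vanishes if \<open>\<phi>\<close> is an involution, and
  \<open>s\<^sub>0 = \<phi>\<close>.

  For an involution, \<open>\<phi> (\<delta> a) = \<phi> a - a = - \<delta> a\<close>, that is, \<open>\<phi>\<close> is inversion on \<open>\<delta> A\<close>. If \<open>\<delta>\<close> is onto
  as well, \<open>\<phi>\<close> is inversion everywhere, and then \<open>\<delta>\<close> is doubling, so that its surjectivity is
  \<open>2\<close>-divisibility. Conversely, inversion is an involution, and doubling is then again \<open>\<delta>\<close>.
\<close>

section \<open>Groups of bijections\<close>

lemma BijGroup_mult_apply: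
  assumes "f \<in> carrier (BijGroup X)" "g \<in> carrier (BijGroup X)" "x \<in> X"
  shows "(f \<otimes>\<^bsub>BijGroup X\<^esub> g) x = f (g x)"
  using assms by (simp add: BijGroup_def compose_eq)

lemma BijGroup_apply_closed:
  assumes "f \<in> carrier (BijGroup X)" "x \<in> X"
  shows "f x \<in> X"
  using assms Bij_imp_funcset[of f X] by (auto simp: BijGroup_def)

lemma BijGroup_one_apply: "x \<in> X \<Longrightarrow> \<one>\<^bsub>BijGroup X\<^esub> x = x"
  by (simp add: BijGroup_def)

lemma BijGroup_eqI:
  assumes "f \<in> carrier (BijGroup X)" "g \<in> carrier (BijGroup X)" "\<And>x. x \<in> X \<Longrightarrow> f x = g x"
  shows "f = g"
  using assms by (auto simp: BijGroup_def dest!: Bij_imp_extensional intro: extensionalityI)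

lemma group_action_subgroup_BijGroup:
  assumes "subgroup H (BijGroup X)"
  shows "group_action (BijGroup X \<lparr>carrier := H\<rparr>) X (\<lambda>g. g)"
  using group.canonical_inj_is_hom[OF group_BijGroup assms]
  by (simp add: group_action_def id_def)

section \<open>Alexander quandles\<close>

locale abelian_group_automorphism = abelian_group A
  for A :: "('a, 'b) ring_scheme" (structure) +
  fixes \<phi> :: "'a \<Rightarrow> 'a"
  assumes automorphism: "\<phi> \<in> auto (add_monoid A)"
begin

abbreviation s :: "'a \<Rightarrow> 'a \<Rightarrow> 'a"
  where "s \<equiv> snd (Alex A \<phi>)"

definition \<delta> :: "'a \<Rightarrow> 'a"
  where "\<delta> a = a \<ominus> \<phi> a"

lemma phi_bij: "bij_betw \<phi> (carrier A) (carrier A)"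
  using automorphism by (simp add: auto_def Bij_def)

lemma phi_closed [simp]: "a \<in> carrier A \<Longrightarrow> \<phi> a \<in> carrier A"
  using phi_bij bij_betwE by blast

lemma phi_add: "a \<in> carrier A \<Longrightarrow> b \<in> carrier A \<Longrightarrow> \<phi> (a \<oplus> b) = \<phi> a \<oplus> \<phi> b"
  using automorphism by (simp add: auto_def hom_def)

lemma phi_hom: "group_hom (add_monoid A) (add_monoid A) \<phi>"
  using automorphism a_group
  by (simp add: auto_def group_hom_def group_hom_axioms_def)

lemma phi_zero: "\<phi> \<zero> = \<zero>"
  using group_hom.hom_one[OF phi_hom] by simp

lemma phi_neg: "a \<in> carrier A \<Longrightarrow> \<phi> (\<ominus> a) = \<ominus> \<phi> a"
  using group_hom.hom_inv[OF phi_hom, of a] by (simp add: a_inv_def)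

lemma delta_closed [simp]: "a \<in> carrier A \<Longrightarrow> \<delta> a \<in> carrier A"
  by (simp add: \<delta>_def)

lemma delta_zero: "\<delta> \<zero> = \<zero>"
  by (simp add: \<delta>_def phi_zero a_minus_def r_neg)

lemma delta_add: "a \<in> carrier A \<Longrightarrow> b \<in> carrier A \<Longrightarrow> \<delta> (a \<oplus> b) = \<delta> a \<oplus> \<delta> b"
  by (simp add: \<delta>_def a_minus_def phi_add minus_add a_ac)

lemma delta_neg: "a \<in> carrier A \<Longrightarrow> \<delta> (\<ominus> a) = \<ominus> \<delta> a"
  by (simp add: \<delta>_def a_minus_def phi_neg minus_add)

lemma phi_delta: "a \<in> carrier A \<Longrightarrow> \<phi> (\<delta> a) = \<delta> (\<phi> a)"
  by (simp add: \<delta>_def a_minus_def phi_add phi_neg)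

lemma phi_plus_delta: "a \<in> carrier A \<Longrightarrow> \<phi> a \<oplus> \<delta> a = a"
  by (simp add: \<delta>_def a_minus_def a_lcomm r_neg)

lemma fst_Alex [simp]: "fst (Alex A \<phi>) = carrier A"
  by (simp add: Alex_def)

lemma s_apply: "a \<in> carrier A \<Longrightarrow> b \<in> carrier A \<Longrightarrow> s a b = \<phi> b \<oplus> \<delta> a"
  by (simp add: Alex_def \<delta>_def a_minus_def phi_add phi_neg a_ac)

lemma s_closed [simp]: "a \<in> carrier A \<Longrightarrow> b \<in> carrier A \<Longrightarrow> s a b \<in> carrier A"
  by (simp add: s_apply)

lemma s_in_BijGroup: "a \<in> carrier A \<Longrightarrow> s a \<in> carrier (BijGroup (carrier A))"
proof -
  assume a: "a \<in> carrier A"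
  have "inj_on (s a) (carrier A)"
    using a bij_betw_imp_inj_on[OF phi_bij] by (auto simp: inj_on_def s_apply)
  moreover have "c \<in> s a ` carrier A" if c: "c \<in> carrier A" for c
  proof -
    obtain b where b: "b \<in> carrier A" "\<phi> b = c \<ominus> \<delta> a"
      using a c phi_bij unfolding bij_betw_def by (metis delta_closed imageE minus_closed)
    then have "s a b = c"
      using a c by (simp add: s_apply a_minus_def a_assoc l_neg)
    with b show ?thesis by blast
  qed
  ultimately have "bij_betw (s a) (carrier A) (carrier A)"
    using a by (auto simp: bij_betw_def)
  moreover have "s a \<in> extensional (carrier A)"
    using a by (simp add: Alex_def)
  ultimately show ?thesis
    by (simp add: BijGroup_def Bij_def)
qed

lemma s_self_distributive:
  assumes "x \<in> carrier A" "y \<in> carrier A" "b \<in> carrier A"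
  shows "s x (s y b) = s (s x y) (s x b)"
proof -
  \<comment> \<open>The last bracket collapses to \<open>\<delta> x\<close>, because \<open>\<phi> + \<delta>\<close> is the identity.\<close>
  have "s (s x y) (s x b) = \<phi> (\<phi> b) \<oplus> \<phi> (\<delta> y) \<oplus> (\<phi> (\<delta> x) \<oplus> \<delta> (\<delta> x))"
    using assms by (simp add: s_apply phi_add delta_add phi_delta a_ac)
  also have "\<dots> = s x (s y b)"
    using assms by (simp add: s_apply phi_add phi_plus_delta)
  finally show ?thesis by simp
qed

lemma is_quandle_Alex: "is_quandle (Alex A \<phi>)"
proof -
  have "s \<in> carrier A \<rightarrow>\<^sub>E carrier (BijGroup (carrier A))"
    using s_in_BijGroup by (auto simp: PiE_def) (simp add: Alex_def)
  moreover have "s x \<otimes>\<^bsub>BijGroup (carrier A)\<^esub> s y = s (s x y) \<otimes>\<^bsub>BijGroup (carrier A)\<^esub> s x"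
    if "x \<in> carrier A" "y \<in> carrier A" for x y
  proof (rule BijGroup_eqI)
    interpret B: group "BijGroup (carrier A)" by (rule group_BijGroup)
    show "s x \<otimes>\<^bsub>BijGroup (carrier A)\<^esub> s y \<in> carrier (BijGroup (carrier A))"
      and "s (s x y) \<otimes>\<^bsub>BijGroup (carrier A)\<^esub> s x \<in> carrier (BijGroup (carrier A))"
      using that by (simp_all add: s_in_BijGroup)
  qed (use that in \<open>simp add: BijGroup_mult_apply s_in_BijGroup s_self_distributive[symmetric]\<close>)
  moreover have "s x x = x" if "x \<in> carrier A" for x
    using that by (simp add: s_apply phi_plus_delta)
  ultimately show ?thesis
    unfolding is_quandle_def case_prod_beta fst_Alex by blast
qed

lemma is_kei_Alex_iff: "is_kei (Alex A \<phi>) \<longleftrightarrow> (\<forall>b\<in>carrier A. \<phi> (\<phi> b) = b)"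
proof -
  interpret B: group "BijGroup (carrier A)" by (rule group_BijGroup)
  have square: "s a [^]\<^bsub>BijGroup (carrier A)\<^esub> (2::nat) = \<one>\<^bsub>BijGroup (carrier A)\<^esub>
      \<longleftrightarrow> (\<forall>b\<in>carrier A. s a (s a b) = b)" (is "?L \<longleftrightarrow> ?R") if a: "a \<in> carrier A" for a
  proof -
    have pow: "s a [^]\<^bsub>BijGroup (carrier A)\<^esub> (2::nat) = s a \<otimes>\<^bsub>BijGroup (carrier A)\<^esub> s a"
      using a by (simp add: numeral_2_eq_2 s_in_BijGroup)
    show ?thesis
    proof
      assume ?L
      then show ?R
        using a by (metis pow BijGroup_one_apply BijGroup_mult_apply s_in_BijGroup)
    next
      assume ?R
      then show ?L
        unfolding pow using a
        by (intro BijGroup_eqI[where X = "carrier A"]) (simp_all add: BijGroup_mult_apply s_in_BijGroup BijGroup_one_apply)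
    qed
  qed
  have twice: "s a (s a b) = \<phi> (\<phi> b) \<oplus> \<delta> (a \<oplus> \<phi> a)"
    if "a \<in> carrier A" "b \<in> carrier A" for a b
    using that by (simp add: s_apply phi_add delta_add phi_delta a_ac)
  have "(\<forall>a\<in>carrier A. \<forall>b\<in>carrier A. s a (s a b) = b) \<longleftrightarrow> (\<forall>b\<in>carrier A. \<phi> (\<phi> b) = b)"
  proof
    assume "\<forall>a\<in>carrier A. \<forall>b\<in>carrier A. s a (s a b) = b"
    then have "\<forall>b\<in>carrier A. s \<zero> (s \<zero> b) = b" by simp
    then show "\<forall>b\<in>carrier A. \<phi> (\<phi> b) = b"
      by (simp add: s_apply delta_zero)
  next
    assume inv: "\<forall>b\<in>carrier A. \<phi> (\<phi> b) = b"
    have "\<delta> (a \<oplus> \<phi> a) = \<zero>" if "a \<in> carrier A" for a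
      using that inv by (simp add: \<delta>_def phi_add a_comm a_minus_def r_neg)
    with inv show "\<forall>a\<in>carrier A. \<forall>b\<in>carrier A. s a (s a b) = b"
      by (simp add: twice)
  qed
  then show ?thesis
    using is_quandle_Alex by (simp add: is_kei_def case_prod_beta square)
qed

section \<open>Connectedness\<close>

lemma s_displacement:
  assumes "a \<in> carrier A" "b \<in> carrier A"
  shows "s a b = b \<oplus> \<delta> (a \<ominus> b)"
proof -
  have "b \<oplus> \<delta> (a \<ominus> b) = b \<oplus> \<ominus> b \<oplus> (\<phi> b \<oplus> \<delta> a)"
    using assms
    by (simp add: a_minus_def delta_add delta_neg) (simp add: \<delta>_def a_minus_def minus_add a_ac)
  with assms show ?thesis
    by (simp add: s_apply r_neg)
qed

text \<open>
  The permutations that preserve every coset of \<open>\<delta> A\<close> form a group containing all \<open>s\<^sub>a\<close>. The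
  induction therefore runs over all base points at once: the step for an inverse moves the base
  point back.
\<close>

lemma Inn_displacement:
  assumes "g \<in> generate (BijGroup (carrier A)) (s ` carrier A)" "b \<in> carrier A"
  shows "\<exists>d\<in>carrier A. g b = b \<oplus> \<delta> d"
  using assms
proof (induction arbitrary: b rule: generate.induct)
  case one
  then show ?case
    using delta_zero by (intro bexI[of _ \<zero>]) (simp_all add: BijGroup_one_apply)
next
  case (incl h)
  then show ?case using s_displacement by auto
next
  case (inv h)
  then obtain a where a: "a \<in> carrier A" "h = s a" by blast
  then have h: "h \<in> carrier (BijGroup (carrier A))" by (simp add: s_in_BijGroup)
  define c where "c = (inv\<^bsub>BijGroup (carrier A)\<^esub> h) b"
  interpret B: group "BijGroup (carrier A)" by (rule group_BijGroup)
  have c: "c \<in> carrier A"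
    unfolding c_def using B.inv_closed[OF h] inv.prems by (rule BijGroup_apply_closed)
  have "h c = b"
    using BijGroup_mult_apply[OF h B.inv_closed[OF h] inv.prems] h inv.prems
    by (simp add: c_def BijGroup_one_apply)
  with c have "b = c \<oplus> \<delta> (a \<ominus> c)"
    using a by (simp add: s_displacement)
  then have "c = b \<oplus> \<delta> (\<ominus> (a \<ominus> c))"
    using a c by (simp add: delta_neg a_assoc r_neg)
  then show ?case
    using a c unfolding c_def[symmetric] by blast
next
  case (eng g h)
  interpret B: group "BijGroup (carrier A)" by (rule group_BijGroup)
  have gh: "g \<in> carrier (BijGroup (carrier A))" "h \<in> carrier (BijGroup (carrier A))"
    using eng.hyps B.generate_in_carrier[of "s ` carrier A"] s_in_BijGroup by auto
  obtain d where d: "d \<in> carrier A" "h b = b \<oplus> \<delta> d"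
    using eng.IH(2) eng.prems by blast
  then obtain e where e: "e \<in> carrier A" "g (h b) = h b \<oplus> \<delta> e"
    using eng.IH(1)[of "h b"] eng.prems by auto
  have "(g \<otimes>\<^bsub>BijGroup (carrier A)\<^esub> h) b = b \<oplus> \<delta> (d \<oplus> e)"
    using d e gh eng.prems by (simp add: BijGroup_mult_apply delta_add a_assoc)
  with d e show ?case by blast
qed

lemma is_connected_Alex_iff: "is_connected (Alex A \<phi>) \<longleftrightarrow> \<delta> ` carrier A = carrier A"
proof -
  interpret B: group "BijGroup (carrier A)" by (rule group_BijGroup)
  let ?H = "generate (BijGroup (carrier A)) (s ` carrier A)"
  have Inn: "Inn (Alex A \<phi>) = BijGroup (carrier A) \<lparr>carrier := ?H\<rparr>"
    by (simp add: Inn_def case_prod_beta)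
  have "subgroup ?H (BijGroup (carrier A))"
    using s_in_BijGroup by (intro B.generate_is_subgroup) auto
  then have "is_connected (Alex A \<phi>) \<longleftrightarrow>
      (\<forall>b\<in>carrier A. \<forall>c\<in>carrier A. \<exists>g\<in>?H. g b = c)"
    using is_quandle_Alex group_action_subgroup_BijGroup
    by (auto simp: is_connected_def transitive_action_def transitive_action_axioms_def Inn)
  also have "\<dots> \<longleftrightarrow> \<delta> ` carrier A = carrier A"
  proof
    assume trans: "\<forall>b\<in>carrier A. \<forall>c\<in>carrier A. \<exists>g\<in>?H. g b = c"
    have "c \<in> \<delta> ` carrier A" if c: "c \<in> carrier A" for c
    proof -
      obtain g where "g \<in> ?H" "g \<zero> = c" using trans c by blast
      then show ?thesis using Inn_displacement[of g \<zero>] by auto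
    qed
    then show "\<delta> ` carrier A = carrier A" by auto
  next
    assume onto: "\<delta> ` carrier A = carrier A"
    show "\<forall>b\<in>carrier A. \<forall>c\<in>carrier A. \<exists>g\<in>?H. g b = c"
    proof (intro ballI)
      fix b c assume bc: "b \<in> carrier A" "c \<in> carrier A"
      then have "c \<ominus> b \<in> \<delta> ` carrier A" using onto by simp
      then obtain d where d: "d \<in> carrier A" "\<delta> d = c \<ominus> b" by auto
      have "s (d \<oplus> b) b = b \<oplus> (c \<ominus> b)"
        using bc d by (simp add: s_displacement) (simp add: a_minus_def a_assoc r_neg)
      also have "\<dots> = c"
        using bc by (simp add: a_minus_def a_lcomm[of b c] r_neg)
      finally show "\<exists>g\<in>?H. g b = c"
        using bc d by (auto intro!: bexI[of _ "s (d \<oplus> b)"] generate.incl)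
    qed
  qed
  finally show ?thesis .
qed

section \<open>Comparison with the Takasaki kei\<close>

text \<open>The automorphism is recovered from the quandle as \<open>\<phi> = s\<^sub>0\<close>.\<close>

lemma Alex_eq_Takasaki_iff: "Alex A \<phi> = Takasaki A \<longleftrightarrow> (\<forall>b\<in>carrier A. \<phi> b = \<ominus> b)"
proof
  assume "Alex A \<phi> = Takasaki A"
  then have eq: "snd (Alex A \<phi>) \<zero> b = snd (Takasaki A) \<zero> b" for b by simp
  show "\<forall>b\<in>carrier A. \<phi> b = \<ominus> b"
  proof
    fix b assume "b \<in> carrier A"
    then show "\<phi> b = \<ominus> b"
      using eq[of b] by (simp add: Takasaki_def Alex_def minus_eq minus_equality[of \<zero> \<zero>])
  qed
next
  assume "\<forall>b\<in>carrier A. \<phi> b = \<ominus> b"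
  then show "Alex A \<phi> = Takasaki A"
    by (auto simp: Takasaki_def Alex_def intro!: restrict_ext)
qed

lemma delta_eq_double:
  assumes "\<forall>b\<in>carrier A. \<phi> b = \<ominus> b" "a \<in> carrier A"
  shows "\<delta> a = [(2::nat)] \<cdot> a"
  using assms by (simp add: \<delta>_def a_minus_def numeral_2_eq_2)

lemma onto_involution_iff:
  "\<delta> ` carrier A = carrier A \<and> (\<forall>b\<in>carrier A. \<phi> (\<phi> b) = b)
    \<longleftrightarrow> two_divisible A \<and> (\<forall>b\<in>carrier A. \<phi> b = \<ominus> b)"
proof -
  have inversion: "\<forall>b\<in>carrier A. \<phi> b = \<ominus> b"
    if onto: "\<delta> ` carrier A = carrier A" and inv: "\<forall>b\<in>carrier A. \<phi> (\<phi> b) = b"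
  proof
    fix b assume "b \<in> carrier A"
    then obtain a where "a \<in> carrier A" "b = \<delta> a" using onto by auto
    then show "\<phi> b = \<ominus> b"
      using inv by (simp add: \<delta>_def a_minus_def phi_add phi_neg minus_add a_comm)
  qed
  have "two_divisible A \<longleftrightarrow> \<delta> ` carrier A = carrier A" if "\<forall>b\<in>carrier A. \<phi> b = \<ominus> b"
    using delta_eq_double[OF that] by (simp add: two_divisible_def cong: image_cong)
  with inversion show ?thesis by auto
qed

end

theorem theorem4p8:
  fixes A :: "('a, 'b) ring_scheme" and \<phi> :: "'a \<Rightarrow> 'a"
  assumes "abelian_group A"
    and "\<phi> \<in> auto (add_monoid A)"
  shows "(is_connected (Alex A \<phi>) \<and> is_kei (Alex A \<phi>)) \<longleftrightarrow>
         (two_divisible A \<and> Alex A \<phi> = Takasaki A)"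
proof -
  interpret abelian_group_automorphism A \<phi>
    using assms by (simp add: abelian_group_automorphism_def abelian_group_automorphism_axioms_def)
  show ?thesis
    unfolding is_connected_Alex_iff is_kei_Alex_iff Alex_eq_Takasaki_iff
    by (rule onto_involution_iff)
qed

end
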